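(* Consider the piecewise-smooth system $\dot x = F^L(x;\mu)$ for $x_1<0$, $\dot x = F^R(x;\mu)$ for $x_1>0$, with $x\in\mathbb{R}^n$, $\mu\in\mathbb{R}$, where $F^L$ and $F^R$ have continuous second derivatives and, near $(x;\mu)=(\mathbf 0,0)$, $$F^L(x;\mu)=Ax+b\mu+\mathcal O(2),\qquad F^R(x;\mu)=c+\mathcal O(1),$$ with $A\in\mathbb{R}^{n\times n}$ and $b,c\in\mathbb{R}^n$. Let $\tilde M$ be the lower-right $(n-1)\times(n-1)$ block of $M=\left(I-\frac{c\,e_1^{\mathsf T}}{c_1}\right)A$. Suppose $c_1\neq0$, that neither $A$ nor $\tilde M$ has an eigenvalue with zero real part, and that $\alpha_L\ne0$, where $\alpha_L,\alpha_S\in\mathbb{R}$ are defined by $$x^L_1(\mu)=\alpha_L\mu+\mathcal O(\mu^2),\qquad \chi(x^S(\mu);\mu)=\alpha_S\mu+\mathcal O(\mu^2).$$ Here $x^L(\mu)$ is the unique local regular equilibrium, $x^S(\mu)$ is the unique local pseudo-equilibrium, and $\chi=F^L_1F^R_1$. Let $D_L$ and $D_S$ be the dimensions of the unstable manifolds of $x^L$ and $x^S$ respectively (as specified in the context). Then $$\operatorname{sgn}(\alpha_L\alpha_S)=(-1)^{D_L+D_S+1}.$$ In particular, if both $x^L$ and $x^S$ are stable (that is, $D_L=D_S=0$), then $\alpha_L\alpha_S<0$, and so the boundary equilibrium bifurcation at $\mu=0$ corresponds to persistence.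
   Context: Notation: $e_1,\dots,e_n$ is the standard basis of $\mathbb{R}^n$; $\mathbf 0$ is the zero vector; subscripts on vectors denote components; $\mathcal O(k)$ denotes terms of order $k$ or greater in $x$ and $\mu$; $\operatorname{sgn}(a)=-1,0,1$ for $a<0$, $a=0$, $a>0$ respectively. For $n=1$, $\tilde M$ is the empty matrix, with determinant $1$ and no eigenvalues. The discontinuity surface is $\Sigma=\{x\in\mathbb{R}^n : x_1=0\}$. The sliding vector field on $\Sigma$ is $$F^S=\frac{F^L_1F^R-F^R_1F^L}{F^L_1-F^R_1},$$ which is well defined near $(\mathbf 0,0)$ when $c_1\ne0$. Sliding regions are the subsets of $\Sigma$ where $\chi<0$; a sliding region is attracting if $F^L_1>0$ and $F^R_1<0$, and repelling if $F^L_1<0$ and $F^R_1>0$. A regular equilibrium is a point $x\in\mathbb{R}^n$ with $F^L(x;\mu)=\mathbf 0$ or $F^R(x;\mu)=\mathbf 0$. A pseudo-equilibrium is a point $x\in\Sigma$ with $F^S(x;\mu)=\mathbf 0$. If $\det(A)\neq0$ and $c_1\ne0$, then in a neighbourhood of $(\mathbf 0,0)$ there is a unique regular equilibrium $x^L(\mu)=-A^{-1}b\mu+\mathcal O(\mu^2)$, a zero of $F^L$. If $\det(\tilde M)\neq0$ and $c_1\neq 0$, then in a neighbourhood of $(\mathbf 0,0)$ there is a unique pseudo-equilibrium $x^S(\mu)$, and $x^S(0)=\mathbf 0$. Admissibility: $x^L(\mu)$ is admissible if $x^L_1(\mu)<0$ and virtual if $x^L_1(\mu)>0$; $x^S(\mu)$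 is admissible if $\chi(x^S(\mu);\mu)<0$ and virtual if $\chi(x^S(\mu);\mu)>0$. The bifurcation at $\mu=0$ is called persistence if, for small $\mu\ne0$, $x^L$ and $x^S$ are admissible for different signs of $\mu$ (exactly one of them is admissible for each sign). Unstable dimensions: $D_L$ is the dimension of the unstable manifold of $x^L(\mu)$ for all sufficiently small $\mu$ for which it is admissible; it equals the number of eigenvalues of $A$, counted with algebraic multiplicity, with positive real part. $D_S$ is the dimension of the unstable manifold of $x^S(\mu)$ in the full system. Let $\tilde D_S$ be the number of eigenvalues of $\tilde M$, counted with algebraic multiplicity, with positive real part (the unstable dimension within the $(n-1)$-dimensional sliding dynamics). Then $D_S=\tilde D_S$ if $c_1<0$ (attracting sliding region) and $D_S=\tilde D_S+1$ if $c_1>0$ (repelling sliding region). *)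

theory Defs
  imports
    "HOL-Analysis.Analysis"
    "HOL-Library.Landau_Symbols"
    "Jordan_Normal_Form.Char_Poly"
begin

no_notation Matrix.vec_index (infixl \<open>$\<close> 100)

text \<open>
  The space \<open>\<real>\<^sup>n\<close> is \<open>real ^ 'n\<close> with \<open>n = CARD('n)\<close>. The index type carries no order, so the
  coordinates are numbered by a bijection \<open>ix\<close> from \<open>{1..n}\<close> onto \<open>'n\<close>: the component \<open>x\<^sub>k\<close> is
  \<open>x $ ix k\<close>. Matrices whose eigenvalues are counted are rewritten with numerical indices, because
  the block of size \<open>n - 1\<close> has no index type of its own (and is empty when \<open>n = 1\<close>).
\<close>

definition coordinate_numbering :: "(nat \<Rightarrow> 'n::finite) \<Rightarrow> bool" where
  "coordinate_numbering ix \<longleftrightarrow> bij_betw ix {1..CARD('n)} UNIV"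

definition numbered_matrix :: "(nat \<Rightarrow> 'n::finite) \<Rightarrow> real ^ 'n ^ 'n \<Rightarrow> real Matrix.mat" where
  "numbered_matrix ix A =
     Matrix.mat CARD('n) CARD('n) (\<lambda>(i, j). A $ ix (i + 1) $ ix (j + 1))"


subsection \<open>Eigenvalues\<close>

definition no_eigenvalue_on_imaginary_axis :: "real Matrix.mat \<Rightarrow> bool" where
  "no_eigenvalue_on_imaginary_axis B \<longleftrightarrow>
     (\<forall>z. eigenvalue (map_mat complex_of_real B) z \<longrightarrow> Re z \<noteq> 0)"

definition unstable_eigenvalue_count :: "real Matrix.mat \<Rightarrow> nat" where
  "unstable_eigenvalue_count B =
     (\<Sum>z | eigenvalue (map_mat complex_of_real B) z \<and> Re z > 0.
        Polynomial.order z (char_poly (map_mat complex_of_real B)))"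

text \<open>The matrix \<open>M = (I - c e\<^sub>1\<^sup>T / c\<^sub>1) A\<close> and its lower-right block of size \<open>n - 1\<close>.\<close>

definition sliding_matrix ::
    "(nat \<Rightarrow> 'n::finite) \<Rightarrow> real ^ 'n ^ 'n \<Rightarrow> real ^ 'n \<Rightarrow> real ^ 'n ^ 'n" where
  "sliding_matrix ix A c =
     (Finite_Cartesian_Product.mat 1 - (\<chi> i j. c $ i * axis (ix 1) 1 $ j / c $ ix 1)) ** A"

definition sliding_block ::
    "(nat \<Rightarrow> 'n::finite) \<Rightarrow> real ^ 'n ^ 'n \<Rightarrow> real ^ 'n \<Rightarrow> real Matrix.mat" where
  "sliding_block ix A c = mat_delete (numbered_matrix ix (sliding_matrix ix A c)) 0 0"

definition D_L :: "(nat \<Rightarrow> 'n::finite) \<Rightarrow> real ^ 'n ^ 'n \<Rightarrow> nat" where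
  "D_L ix A = unstable_eigenvalue_count (numbered_matrix ix A)"

text \<open>
  If \<open>c\<^sub>1 > 0\<close> the sliding region is repelling, and the direction transverse to the discontinuity
  surface contributes one more unstable dimension.
\<close>

definition D_S :: "(nat \<Rightarrow> 'n::finite) \<Rightarrow> real ^ 'n ^ 'n \<Rightarrow> real ^ 'n \<Rightarrow> nat" where
  "D_S ix A c =
     unstable_eigenvalue_count (sliding_block ix A c) + (if c $ ix 1 > 0 then 1 else 0)"


subsection \<open>The piecewise-smooth system\<close>

definition C2 :: "('a::real_normed_vector \<Rightarrow> 'b::real_normed_vector) \<Rightarrow> bool" where
  "C2 f \<longleftrightarrow>
     (\<exists>(f' :: 'a \<Rightarrow> 'a \<Rightarrow>\<^sub>L 'b) (f'' :: 'a \<Rightarrow> 'a \<Rightarrow>\<^sub>L 'a \<Rightarrow>\<^sub>L 'b).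
        (\<forall>x. (f has_derivative blinfun_apply (f' x)) (at x)) \<and>
        (\<forall>x. (f' has_derivative blinfun_apply (f'' x)) (at x)) \<and>
        continuous_on UNIV f'')"

definition sliding_field ::
    "(nat \<Rightarrow> 'n::finite) \<Rightarrow> (real ^ 'n \<Rightarrow> real \<Rightarrow> real ^ 'n) \<Rightarrow> (real ^ 'n \<Rightarrow> real \<Rightarrow> real ^ 'n)
      \<Rightarrow> real ^ 'n \<Rightarrow> real \<Rightarrow> real ^ 'n" where
  "sliding_field ix FL FR x \<mu> =
     (1 / (FL x \<mu> $ ix 1 - FR x \<mu> $ ix 1)) *\<^sub>R
       ((FL x \<mu> $ ix 1) *\<^sub>R FR x \<mu> - (FR x \<mu> $ ix 1) *\<^sub>R FL x \<mu>)"

definition chi ::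
    "(nat \<Rightarrow> 'n::finite) \<Rightarrow> (real ^ 'n \<Rightarrow> real \<Rightarrow> real ^ 'n) \<Rightarrow> (real ^ 'n \<Rightarrow> real \<Rightarrow> real ^ 'n)
      \<Rightarrow> real ^ 'n \<Rightarrow> real \<Rightarrow> real" where
  "chi ix FL FR x \<mu> = FL x \<mu> $ ix 1 * FR x \<mu> $ ix 1"

definition regular_equilibrium ::
    "(real ^ 'n::finite \<Rightarrow> real \<Rightarrow> real ^ 'n) \<Rightarrow> (real ^ 'n \<Rightarrow> real \<Rightarrow> real ^ 'n)
      \<Rightarrow> real ^ 'n \<Rightarrow> real \<Rightarrow> bool" where
  "regular_equilibrium FL FR x \<mu> \<longleftrightarrow> FL x \<mu> = 0 \<or> FR x \<mu> = 0"

text \<open>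
  The first inequation says that the sliding field is defined at the point; without it, division
  by zero would turn every point with a vanishing denominator into a pseudo-equilibrium.
\<close>

definition pseudo_equilibrium ::
    "(nat \<Rightarrow> 'n::finite) \<Rightarrow> (real ^ 'n \<Rightarrow> real \<Rightarrow> real ^ 'n) \<Rightarrow> (real ^ 'n \<Rightarrow> real \<Rightarrow> real ^ 'n)
      \<Rightarrow> real ^ 'n \<Rightarrow> real \<Rightarrow> bool" where
  "pseudo_equilibrium ix FL FR x \<mu> \<longleftrightarrow>
     FL x \<mu> $ ix 1 \<noteq> FR x \<mu> $ ix 1 \<and> x $ ix 1 = 0 \<and> sliding_field ix FL FR x \<mu> = 0"

text \<open>
  \<open>\<xi> \<mu>\<close> is the unique point satisfying \<open>E\<close> for the parameter value \<open>\<mu>\<close>, in a neighbourhood of the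
  origin of \<open>(x, \<mu>)\<close>-space. Continuity at \<open>0\<close> makes the point \<open>(\<xi> \<mu>, \<mu>)\<close> lie in that
  neighbourhood for all small \<open>\<mu>\<close>, so the point exists as well.
\<close>

definition unique_local_branch ::
    "('a::real_normed_vector \<Rightarrow> real \<Rightarrow> bool) \<Rightarrow> (real \<Rightarrow> 'a) \<Rightarrow> bool" where
  "unique_local_branch E \<xi> \<longleftrightarrow>
     \<xi> 0 = 0 \<and> isCont \<xi> 0 \<and> (\<forall>\<^sub>F (x, \<mu>) in nhds (0, 0). E x \<mu> \<longleftrightarrow> x = \<xi> \<mu>)"

definition admissible_L :: "(nat \<Rightarrow> 'n::finite) \<Rightarrow> (real \<Rightarrow> real ^ 'n) \<Rightarrow> real \<Rightarrow> bool" where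
  "admissible_L ix xL \<mu> \<longleftrightarrow> xL \<mu> $ ix 1 < 0"

definition admissible_S ::
    "(nat \<Rightarrow> 'n::finite) \<Rightarrow> (real ^ 'n \<Rightarrow> real \<Rightarrow> real ^ 'n) \<Rightarrow> (real ^ 'n \<Rightarrow> real \<Rightarrow> real ^ 'n)
      \<Rightarrow> (real \<Rightarrow> real ^ 'n) \<Rightarrow> real \<Rightarrow> bool" where
  "admissible_S ix FL FR xS \<mu> \<longleftrightarrow> chi ix FL FR (xS \<mu>) \<mu> < 0"

text \<open>
  The arguments say for which parameter values each of the two equilibria is admissible.
\<close>

definition persistence :: "(real \<Rightarrow> bool) \<Rightarrow> (real \<Rightarrow> bool) \<Rightarrow> bool" where
  "persistence admL admS \<longleftrightarrow>
     (\<forall>\<^sub>F \<mu> in at_left 0. admL \<mu> \<and> \<not> admS \<mu>) \<and> (\<forall>\<^sub>F \<mu> in at_right 0. admS \<mu> \<and> \<not> admL \<mu>) \<or>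
     (\<forall>\<^sub>F \<mu> in at_left 0. admS \<mu> \<and> \<not> admL \<mu>) \<and> (\<forall>\<^sub>F \<mu> in at_right 0. admL \<mu> \<and> \<not> admS \<mu>)"

end

theory Submission
  imports Defs
begin

text \<open>
  Let \<open>w = A\<^sup>-\<^sup>1 c\<close>. Expanding both equilibria to first order in \<open>\<mu>\<close> gives
  \<open>\<alpha>\<^sub>L = - (A\<^sup>-\<^sup>1 b)\<^sub>1\<close> and \<open>\<alpha>\<^sub>S = - c\<^sub>1\<^sup>2 \<alpha>\<^sub>L / w\<^sub>1\<close>, and Cramer's rule with a row reduction gives
  \<open>w\<^sub>1 det A = c\<^sub>1 det M\<close>, where \<open>M\<close> is the sliding block. So the sign of \<open>\<alpha>\<^sub>L \<alpha>\<^sub>S\<close> is that of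
  \<open>- c\<^sub>1 det A det M\<close>. Nonreal eigenvalues come in conjugate pairs, so the sign of the determinant of
  a hyperbolic real matrix is given by the parity of the number of its stable eigenvalues.
\<close>

section \<open>The sign of the determinant of a hyperbolic real matrix\<close>

lemma order_cnj:
  fixes p :: "complex poly"
  assumes "map_poly cnj p = p"
  shows "Polynomial.order (cnj z) p = Polynomial.order z p"
proof -
  interpret map_poly_inj_idom_divide_hom cnj by unfold_locales auto
  show ?thesis using order_hom[of z p] assms by simp
qed

text \<open>Factors over the lower half plane are the conjugates of those over the upper one, so
  together they give a squared modulus. The splitting is applied both to the true factors of a
  polynomial and to their signs.\<close>

lemma prod_conjugate_symmetric:
  fixes f :: "complex \<Rightarrow> complex"
  assumes "finite R" and "cnj ` R = R" and "\<And>z. z \<in> R \<Longrightarrow> f (cnj z) = cnj (f z)"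
  shows "prod f R = of_real ((cmod (\<Prod>z | z \<in> R \<and> Im z > 0. f z))\<^sup>2) * (\<Prod>z | z \<in> R \<and> Im z = 0. f z)"
proof -
  let ?U = "{z \<in> R. Im z > 0}" and ?L = "{z \<in> R. Im z < 0}" and ?Z = "{z \<in> R. Im z = 0}"
  have "cnj ` ?U = ?L"
  proof (intro equalityI subsetI)
    fix z assume z: "z \<in> ?L"
    then have "cnj z \<in> R" using assms(2) by blast
    with z show "z \<in> cnj ` ?U" by (intro image_eqI[of _ _ "cnj z"]) auto
  qed (use assms(2) in auto)
  then have "prod f ?L = (\<Prod>z\<in>?U. f (cnj z))"
    by (metis (no_types, lifting) complex_cnj_cancel_iff inj_onI prod.reindex_cong)
  also have "\<dots> = cnj (prod f ?U)" by (simp add: assms(3))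
  finally have L: "prod f ?L = cnj (prod f ?U)" .
  have "R = (?U \<union> ?L) \<union> ?Z" by auto
  then have "prod f R = prod f ((?U \<union> ?L) \<union> ?Z)" by simp
  also have "\<dots> = prod f (?U \<union> ?L) * prod f ?Z"
    by (rule prod.union_disjoint) (use assms(1) in auto)
  also have "prod f (?U \<union> ?L) = prod f ?U * prod f ?L"
    by (rule prod.union_disjoint) (use assms(1) in auto)
  finally show ?thesis by (simp only: L complex_norm_square)
qed

text \<open>The value at 0 of a monic polynomial is the product of \<open>- z\<close> over its
  roots, with multiplicity. Nonreal pairs contribute positively, so the sign comes from the real
  roots. Counting also the nonreal roots of positive real part keeps the parity, since conjugate
  roots share real part and multiplicity.\<close>

lemma sgn_poly_0:
  fixes p :: "real poly"
  defines "q \<equiv> map_poly complex_of_real p"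
  assumes monic: "lead_coeff p = 1" and hyperbolic: "\<And>z. poly q z = 0 \<Longrightarrow> Re z \<noteq> 0"
  shows "sgn (poly p 0) = (-1) ^ (\<Sum>z | poly q z = 0 \<and> Re z > 0. Polynomial.order z q)"
proof -
  let ?m = "\<lambda>z. Polynomial.order z q"
  define R where "R = {z. poly q z = 0}"
  define f where "f = (\<lambda>z. (- z) ^ ?m z)"
  \<comment> \<open>At real roots \<open>g\<close> is the sign of \<open>f\<close>; at nonreal roots
    hyperbolicity makes it 1 or -1, so that conjugate pairs multiply to 1.\<close>
  define g where "g = (\<lambda>z. complex_of_real (sgn (- Re z)) ^ ?m z)"
  have q: "q \<noteq> 0" "lead_coeff q = 1"
    using monic by (auto simp: q_def)
  have fin: "finite R" unfolding R_def by (rule poly_roots_finite[OF q(1)])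
  have real: "map_poly cnj q = q"
    by (simp add: q_def poly_eq_iff coeff_map_poly)
  have root_cnj: "cnj z \<in> R" if "z \<in> R" for z
    using poly_cnj[of q z] that by (simp add: R_def real)
  have sym: "cnj ` R = R"
    using root_cnj by (auto simp: image_iff) (metis complex_cnj_cnj)
  have "q = (\<Prod>z\<in>R. [:- z, 1:] ^ ?m z)"
    using complex_poly_decompose[of q] q(2) by (simp add: R_def)
  then have "poly q 0 = prod f R"
    by (metis (no_types, lifting) f_def poly_pCons mult_zero_left add.right_neutral poly_power poly_prod prod.cong)
  also have "\<dots> = of_real ((cmod (\<Prod>z | z \<in> R \<and> Im z > 0. f z))\<^sup>2) * (\<Prod>z | z \<in> R \<and> Im z = 0. f z)"
    by (rule prod_conjugate_symmetric[OF fin sym]) (simp add: f_def order_cnj[OF real])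
  also have "(\<Prod>z | z \<in> R \<and> Im z = 0. f z) = of_real (\<Prod>z | z \<in> R \<and> Im z = 0. (- Re z) ^ ?m z)"
    unfolding of_real_prod by (rule prod.cong) (auto simp: f_def complex_eq_iff intro!: arg_cong[of _ _ "\<lambda>x. x ^ _"])
  finally have "complex_of_real (poly p 0) = of_real ((cmod (\<Prod>z | z \<in> R \<and> Im z > 0. f z))\<^sup>2 *
      (\<Prod>z | z \<in> R \<and> Im z = 0. (- Re z) ^ ?m z))"
    by (simp add: q_def poly_0_coeff_0 coeff_map_poly)
  then have p0: "poly p 0 = (cmod (\<Prod>z | z \<in> R \<and> Im z > 0. f z))\<^sup>2 *
      (\<Prod>z | z \<in> R \<and> Im z = 0. (- Re z) ^ ?m z)"
    unfolding of_real_eq_iff .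
  have "(\<Prod>z | z \<in> R \<and> Im z > 0. f z) \<noteq> 0"
    using hyperbolic fin by (auto simp: f_def R_def)
  then have "sgn (poly p 0) = sgn (\<Prod>z | z \<in> R \<and> Im z = 0. (- Re z) ^ ?m z)"
    unfolding p0 by (simp add: sgn_mult)
  also have "\<dots> = (\<Prod>z | z \<in> R \<and> Im z = 0. sgn (- Re z) ^ ?m z)"
  proof -
    have "sgn (prod h S) = (\<Prod>z\<in>S. sgn (h z))" if "finite S" for h :: "complex \<Rightarrow> real" and S
      using that by induction (auto simp: sgn_mult)
    then show ?thesis by (simp add: fin del: sgn_minus)
  qed
  finally have sgn_eq: "complex_of_real (sgn (poly p 0)) = (\<Prod>z | z \<in> R \<and> Im z = 0. g z)"
    by (simp add: g_def)
  \<comment> \<open>The same splitting read backwards: the nonreal roots contribute modulus one and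
    may be put back into the product.\<close>
  have "prod g R = of_real ((cmod (\<Prod>z | z \<in> R \<and> Im z > 0. g z))\<^sup>2) * (\<Prod>z | z \<in> R \<and> Im z = 0. g z)"
    by (rule prod_conjugate_symmetric[OF fin sym]) (simp add: g_def order_cnj[OF real])
  also have "cmod (\<Prod>z | z \<in> R \<and> Im z > 0. g z) = 1"
    unfolding prod_norm[symmetric] 
    by (rule prod.neutral) (use hyperbolic in \<open>auto simp: g_def R_def norm_power sgn_if\<close>)
  finally have "complex_of_real (sgn (poly p 0)) = prod g R"
    using sgn_eq by simp
  also have "prod g R = (\<Prod>z\<in>R. if Re z > 0 then (-1) ^ ?m z else 1)"
    by (rule prod.cong) (use hyperbolic in \<open>auto simp: g_def R_def sgn_if\<close>)
  also have "\<dots> = (\<Prod>z | z \<in> R \<and> Re z > 0. (-1) ^ ?m z)"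
    by (rule prod.inter_filter[symmetric, OF fin])
  also have "\<dots> = of_real ((-1) ^ (\<Sum>z | z \<in> R \<and> Re z > 0. ?m z))"
    by (simp add: power_sum)
  finally show ?thesis unfolding of_real_eq_iff by (simp add: R_def)
qed

text \<open>The characteristic polynomial at 0 is \<open>det (- B)\<close>, which supplies the
  \<open>n\<close> in the exponent. The case \<open>n = 0\<close> is included, for the empty sliding
  block of a one-dimensional system.\<close>

lemma sgn_det_eq_unstable_parity:
  assumes "B \<in> carrier_mat n n" and "no_eigenvalue_on_imaginary_axis B"
  shows "sgn (Determinant.det B) = (-1) ^ (n + unstable_eigenvalue_count B)"
proof -
  let ?B = "map_mat complex_of_real B"
  have B: "?B \<in> carrier_mat n n" using assms(1) by simp
  have cp: "char_poly ?B = map_poly complex_of_real (char_poly B)"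
    by (rule of_real_hom.char_poly_hom[OF assms(1)])
  have ev: "eigenvalue ?B z \<longleftrightarrow> poly (map_poly complex_of_real (char_poly B)) z = 0" for z
    using eigenvalue_root_char_poly[OF B] cp by simp
  have "lead_coeff (char_poly B) = 1"
    using degree_monic_char_poly[OF assms(1)] by auto
  then have "sgn (poly (char_poly B) 0) = (-1) ^ unstable_eigenvalue_count B"
    unfolding unstable_eigenvalue_count_def cp ev
    by (rule sgn_poly_0) (use assms(2) ev in \<open>auto simp: no_eigenvalue_on_imaginary_axis_def\<close>)
  moreover have "poly (char_poly B) 0 = (-1) ^ n * Determinant.det B"
  proof -
    have "char_matrix B 0 = B" using assms(1) by (auto simp: char_matrix_def)
    moreover have "- B = (-1) \<cdot>\<^sub>m B" using assms(1) by auto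
    ultimately show ?thesis
      using char_poly_matrix[OF assms(1), of 0] assms(1) by (simp add: det_smult)
  qed
  ultimately have "(-1) ^ n * sgn (Determinant.det B) = (-1) ^ unstable_eigenvalue_count B"
    by (simp add: sgn_mult power_sgn)
  then have "(-1) ^ n * ((-1) ^ n * sgn (Determinant.det B)) = (-1) ^ (n + unstable_eigenvalue_count B)"
    by (simp add: power_add)
  then show ?thesis by (simp flip: mult.assoc power_add mult_2)
qed

section \<open>Matrices with numerical indices and the determinant of the sliding block\<close>

lemma numbered_matrix_carrier [simp]:
  "numbered_matrix ix (X :: real ^ 'n ^ 'n) \<in> carrier_mat CARD('n::finite) CARD('n)"
  by (simp add: numbered_matrix_def)

lemma numbered_matrix_dim [simp]:
  "dim_row (numbered_matrix ix (X :: real ^ 'n::finite ^ 'n)) = CARD('n)"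
  "dim_col (numbered_matrix ix (X :: real ^ 'n::finite ^ 'n)) = CARD('n)"
  by (simp_all add: numbered_matrix_def)

text \<open>Matrix rows and columns count from 0 and coordinates from 1; the shift by one is
  absorbed here for sums over coordinates.\<close>

lemma sum_coordinate_numbering:
  fixes f :: "'n::finite \<Rightarrow> 'b::comm_monoid_add"
  assumes "coordinate_numbering ix"
  shows "(\<Sum>k<CARD('n). f (ix (k + 1))) = (\<Sum>i\<in>UNIV. f i)"
proof -
  have "(\<Sum>k<CARD('n). f (ix (k + 1))) = (\<Sum>k\<in>{1..CARD('n)}. f (ix k))"
    by (rule sum.reindex_bij_witness[of _ "\<lambda>k. k - 1" "\<lambda>k. k + 1"]) auto
  also have "\<dots> = (\<Sum>i\<in>UNIV. f i)"
    using assms unfolding coordinate_numbering_def by (rule sum.reindex_bij_betw)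
  finally show ?thesis .
qed

lemma coordinate_numbering_eq_iff:
  assumes "coordinate_numbering (ix :: nat \<Rightarrow> 'n::finite)" and "i < CARD('n)" and "j < CARD('n)"
  shows "ix (i + 1) = ix (j + 1) \<longleftrightarrow> i = j"
proof -
  have "inj_on ix {1..CARD('n)}"
    using assms(1) unfolding coordinate_numbering_def bij_betw_def by blast
  then show ?thesis
    using assms(2,3) inj_on_eq_iff[of ix "{1..CARD('n)}" "i + 1" "j + 1"] by simp
qed

lemma coordinate_numbering_surj:
  assumes "coordinate_numbering (ix :: nat \<Rightarrow> 'n::finite)"
  obtains i where "i < CARD('n)" and "k = ix (i + 1)"
proof -
  have "k \<in> ix ` {1..CARD('n)}"
    using assms unfolding coordinate_numbering_def bij_betw_def by blast
  then obtain m where "m \<in> {1..CARD('n)}" "k = ix m" by auto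
  then show ?thesis by (intro that[of "m - 1"]) auto
qed

lemma numbered_matrix_mult:
  fixes X Y :: "real ^ 'n::finite ^ 'n"
  assumes "coordinate_numbering ix"
  shows "numbered_matrix ix (X ** Y) = numbered_matrix ix X * numbered_matrix ix Y"
proof (rule eq_matI)
  fix i j assume "i < dim_row (numbered_matrix ix X * numbered_matrix ix Y)"
    and "j < dim_col (numbered_matrix ix X * numbered_matrix ix Y)"
  then show "numbered_matrix ix (X ** Y) $$ (i, j) = (numbered_matrix ix X * numbered_matrix ix Y) $$ (i, j)"
    using sum_coordinate_numbering[OF assms, of "\<lambda>k. X $ ix (i + 1) $ k * Y $ k $ ix (j + 1)"]
    by (simp add: numbered_matrix_def scalar_prod_def matrix_matrix_mult_def atLeast0LessThan)
qed simp_all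

text \<open>Determinants are taken with numerical indices, while the inverse must act on
  \<open>real ^ 'n\<close>. A nonzero kernel vector of \<open>X\<close>, renumbered, would be one of
  its numbered matrix; so \<open>X\<close> is injective, and its left inverse is two-sided.\<close>

lemma det_numbered_matrix_nonzero_imp_inverse:
  fixes X :: "real ^ 'n::finite ^ 'n"
  assumes "coordinate_numbering ix" and "Determinant.det (numbered_matrix ix X) \<noteq> 0"
  obtains Y where "Y ** X = Finite_Cartesian_Product.mat 1" and "X ** Y = Finite_Cartesian_Product.mat 1"
proof -
  have "x = 0" if "X *v x = 0" for x
  proof (rule ccontr)
    assume "x \<noteq> 0"
    then obtain k where k: "x $ k \<noteq> 0" by (auto simp: Finite_Cartesian_Product.vec_eq_iff)
    obtain i where i: "i < CARD('n)" "k = ix (i + 1)"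
      using coordinate_numbering_surj[OF assms(1)] .
    define v where "v = Matrix.vec CARD('n) (\<lambda>i. x $ ix (i + 1))"
    have "v \<in> carrier_vec CARD('n)" "v \<noteq> 0\<^sub>v CARD('n)"
      using i k by (auto simp: v_def dest: arg_cong[of _ _ "\<lambda>v. vec_index v i"])
    moreover have "numbered_matrix ix X *\<^sub>v v = 0\<^sub>v CARD('n)"
    proof (rule eq_vecI)
      fix j assume j: "j < dim_vec (0\<^sub>v CARD('n))"
      have "vec_index (numbered_matrix ix X *\<^sub>v v) j = (\<Sum>k<CARD('n). X $ ix (j + 1) $ ix (k + 1) * x $ ix (k + 1))"
        using j by (simp add: numbered_matrix_def v_def scalar_prod_def atLeast0LessThan)
      also have "\<dots> = (X *v x) $ ix (j + 1)"
        using sum_coordinate_numbering[OF assms(1), of "\<lambda>k. X $ ix (j + 1) $ k * x $ k"]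
        by (simp add: matrix_vector_mult_def)
      finally show "vec_index (numbered_matrix ix X *\<^sub>v v) j = vec_index (0\<^sub>v CARD('n)) j"
        using that j by simp
    qed simp
    ultimately show False
      using assms(2) det_0_iff_vec_prod_zero_field[OF numbered_matrix_carrier[of ix X]] by blast
  qed
  then obtain Y where "Y ** X = Finite_Cartesian_Product.mat 1"
    using matrix_left_invertible_ker by blast
  then show ?thesis using that matrix_left_right_inverse by blast
qed

text \<open>This serves the two elementary factors of the next determinant identity, both triangular
  in the order of the numbering.\<close>

lemma det_numbered_lower_triangular:
  fixes X :: "real ^ 'n::finite ^ 'n"
  assumes "\<And>i j. i < j \<Longrightarrow> j < CARD('n) \<Longrightarrow> X $ ix (i + 1) $ ix (j + 1) = 0"
  shows "Determinant.det (numbered_matrix ix X) = (\<Prod>i<CARD('n). X $ ix (i + 1) $ ix (i + 1))"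
  using assms
  by (subst det_lower_triangular[OF _ numbered_matrix_carrier])
    (auto simp: numbered_matrix_def prod_list_diag_prod atLeast0LessThan)

text \<open>
  With \<open>E\<close> the row operation clearing column 1 below the pivot \<open>c\<^sub>1\<close>, and \<open>W\<close> the identity with its
  first column replaced by \<open>w\<close>, the matrix \<open>E A W\<close> has first column \<open>c\<^sub>1 e\<^sub>1\<close> and lower-right block
  \<open>sliding_block ix A c\<close>.
\<close>

lemma det_sliding_block:
  fixes A :: "real ^ 'n::finite ^ 'n"
  assumes ix: "coordinate_numbering ix" and c1: "c $ ix 1 \<noteq> 0" and w: "A *v w = c"
  shows "Determinant.det (numbered_matrix ix A) * w $ ix 1 =
    c $ ix 1 * Determinant.det (sliding_block ix A c)"
proof -
  define N where "N = CARD('n)"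
  have N: "N > 0" by (simp add: N_def)
  \<comment> \<open>Testing \<open>i = j\<close> first keeps the pivot entry equal to 1, so that
    \<open>E\<close> leaves row 1 alone.\<close>
  define E :: "real ^ 'n ^ 'n" where
    "E = (\<chi> i j. if i = j then 1 else if j = ix 1 then - c $ i / c $ ix 1 else 0)"
  define W :: "real ^ 'n ^ 'n" where
    "W = (\<chi> i j. if j = ix 1 then w $ i else if i = j then 1 else 0)"
  define X where "X = E ** A ** W"
  have ix_1: "ix (Suc i) = ix (Suc 0) \<longleftrightarrow> i = 0" if "i < CARD('n)" for i
    using coordinate_numbering_eq_iff[OF ix that, of 0] by simp
  have ix_eq: "ix (Suc i) = ix (Suc j) \<longleftrightarrow> i = j" if "i < CARD('n)" "j < CARD('n)" for i j
    using coordinate_numbering_eq_iff[OF ix that] by simp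
  have E: "Determinant.det (numbered_matrix ix E) = 1"
    by (subst det_numbered_lower_triangular) (auto simp: E_def ix_1 ix_eq)
  have "Determinant.det (numbered_matrix ix W) = (\<Prod>i<CARD('n). W $ ix (i + 1) $ ix (i + 1))"
    by (rule det_numbered_lower_triangular) (simp add: W_def ix_1 ix_eq)
  also have "\<dots> = (\<Prod>i<N. if i = 0 then w $ ix 1 else 1)"
    unfolding N_def by (rule prod.cong) (auto simp: W_def ix_1)
  finally have W: "Determinant.det (numbered_matrix ix W) = w $ ix 1"
    using N by simp
  have AW: "(A ** W) $ i $ j = (if j = ix 1 then c $ i else A $ i $ j)" for i j
  proof (cases "j = ix 1")
    case True
    have "(A ** W) $ i $ j = (A *v w) $ i"
      by (simp add: True W_def matrix_matrix_mult_def matrix_vector_mult_def)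
    then show ?thesis using True w by simp
  next
    case False
    have "(A ** W) $ i $ j = (\<Sum>k\<in>UNIV. A $ i $ k * W $ k $ j)"
      by (simp add: matrix_matrix_mult_def)
    also have "\<dots> = (\<Sum>k\<in>UNIV. if k = j then A $ i $ k else 0)"
      by (rule sum.cong) (use False in \<open>auto simp: W_def\<close>)
    finally show ?thesis using False by simp
  qed
  have EY: "(E ** Y) $ i $ j = Y $ i $ j - (if i = ix 1 then 0 else c $ i / c $ ix 1 * Y $ ix 1 $ j)"
    for Y :: "real ^ 'n ^ 'n" and i j
  proof -
    have "(E ** Y) $ i $ j = (\<Sum>k\<in>UNIV. (if i = k then Y $ k $ j else 0) -
        (if k = ix 1 then if i = ix 1 then 0 else c $ i / c $ ix 1 * Y $ k $ j else 0))"
      unfolding matrix_matrix_mult_def by (auto simp: E_def intro!: sum.cong)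
    then show ?thesis by (simp add: sum_subtractf)
  qed
  have X: "X $ i $ j = (A ** W) $ i $ j - (if i = ix 1 then 0 else c $ i / c $ ix 1 * (A ** W) $ ix 1 $ j)" for i j
    by (simp only: X_def matrix_mul_assoc[symmetric] EY)
  have col: "X $ i $ ix 1 = (if i = ix 1 then c $ ix 1 else 0)" for i
    using c1 by (simp add: X AW)
  \<comment> \<open>Off row 1, \<open>E\<close> has the same rows as the factor
    \<open>I - c e1^T / c1\<close> of the sliding matrix. They differ only in row 1, which is zero
    in that factor, so the blocks agree although \<open>X\<close> keeps a nonzero pivot.\<close>
  have block: "X $ i $ j = sliding_matrix ix A c $ i $ j" if "i \<noteq> ix 1" "j \<noteq> ix 1" for i j
  proof -
    have "sliding_matrix ix A c $ i $ j = (\<Sum>k\<in>UNIV. (if i = k then A $ k $ j else 0) -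
        (if k = ix 1 then c $ i / c $ ix 1 * A $ k $ j else 0))"
      unfolding sliding_matrix_def matrix_matrix_mult_def Finite_Cartesian_Product.mat_def
      by (auto simp: axis_def intro!: sum.cong)
    then show ?thesis using that by (simp add: X AW sum_subtractf)
  qed
  have "mat_delete (numbered_matrix ix X) 0 0 = sliding_block ix A c"
    unfolding sliding_block_def mat_delete_def
    by (rule eq_matI) (auto simp: numbered_matrix_def block ix_1)
  then have cofactor: "cofactor (numbered_matrix ix X) 0 0 = Determinant.det (sliding_block ix A c)"
    by (simp add: cofactor_def)
  have "Determinant.det (numbered_matrix ix X) =
      (\<Sum>i<N. numbered_matrix ix X $$ (i, 0) * cofactor (numbered_matrix ix X) i 0)"
    by (rule laplace_expansion_column) (auto simp: N_def)
  also have "\<dots> = (\<Sum>i<N. if i = 0 then c $ ix 1 * cofactor (numbered_matrix ix X) 0 0 else 0)"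
  proof (rule sum.cong)
    fix i assume "i \<in> {..<N}"
    then show "numbered_matrix ix X $$ (i, 0) * cofactor (numbered_matrix ix X) i 0 =
        (if i = 0 then c $ ix 1 * cofactor (numbered_matrix ix X) 0 0 else 0)"
      using col[of "ix (Suc i)"] by (simp add: numbered_matrix_def N_def ix_1)
  qed simp
  also have "\<dots> = c $ ix 1 * Determinant.det (sliding_block ix A c)"
    using N by (simp add: cofactor)
  moreover have "Determinant.det (numbered_matrix ix X) = Determinant.det (numbered_matrix ix A) * w $ ix 1"
    unfolding X_def numbered_matrix_mult[OF ix]
    by (simp add: E W det_mult[OF numbered_matrix_carrier numbered_matrix_carrier]
        det_mult[OF mult_carrier_mat[OF numbered_matrix_carrier numbered_matrix_carrier] numbered_matrix_carrier])
  ultimately show ?thesis by simp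
qed

section \<open>First-order expansions and signs near 0\<close>

lemma bigo_tendsto_0:
  fixes f :: "'a \<Rightarrow> real"
  assumes "f \<in> O[F](g)" and "(g \<longlongrightarrow> 0) F"
  shows "(f \<longlongrightarrow> 0) F"
proof -
  obtain K where "\<forall>\<^sub>F x in F. norm (f x) \<le> K * norm (g x)"
    using assms(1) by (elim landau_o.bigE)
  then show ?thesis
    using tendsto_0_le[OF assms(2), of f K] by (simp add: mult.commute)
qed

lemma bigo_norm_linear_image:
  fixes f :: "'a \<Rightarrow> 'b::real_normed_vector"
  assumes "bounded_linear T"
  shows "(\<lambda>x. norm (T (f x))) \<in> O[F](\<lambda>x. norm (f x))"
  by (rule bigoI[where c = "onorm T"]) (use onorm[OF assms] in simp)

lemma bigo_norm_add:
  fixes f g :: "'a \<Rightarrow> 'b::real_normed_vector" and h :: "'a \<Rightarrow> real"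
  assumes "(\<lambda>x. norm (f x)) \<in> O[F](h)" and "(\<lambda>x. norm (g x)) \<in> O[F](h)"
  shows "(\<lambda>x. norm (f x + g x)) \<in> O[F](h)"
proof -
  have "(\<lambda>x. norm (f x + g x)) \<in> O[F](\<lambda>x. norm (f x) + norm (g x))"
    by (rule bigoI[where c = 1]) (simp add: norm_triangle_ineq)
  also have "(\<lambda>x. norm (f x) + norm (g x)) \<in> O[F](h)"
    using assms by (rule sum_in_bigo)
  finally show ?thesis .
qed

text \<open>
  The error bound involves the unknown \<open>z\<close> itself; smallness of \<open>z\<close> absorbs it and gives
  \<open>z \<mu> = O(\<mu>)\<close> first.
\<close>

lemma implicit_linear_expansion:
  fixes z :: "real \<Rightarrow> 'a::real_normed_vector"
  assumes lim: "(z \<longlongrightarrow> 0) (nhds 0)"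
    and err: "(\<lambda>\<mu>. norm (z \<mu> - \<mu> *\<^sub>R v)) \<in> O[nhds 0](\<lambda>\<mu>. (norm (z \<mu>) + \<bar>\<mu>\<bar>)\<^sup>2)"
  shows "(\<lambda>\<mu>. norm (z \<mu> - \<mu> *\<^sub>R v)) \<in> O[nhds 0](\<lambda>\<mu>. \<mu>\<^sup>2)"
proof -
  obtain K where K: "K > 0"
    and bound: "\<forall>\<^sub>F \<mu> in nhds 0. norm (z \<mu> - \<mu> *\<^sub>R v) \<le> K * (norm (z \<mu>) + \<bar>\<mu>\<bar>)\<^sup>2"
    using err by (elim landau_o.bigE) auto
  have "((\<lambda>\<mu>. K * (norm (z \<mu>) + \<bar>\<mu>\<bar>)) \<longlongrightarrow> K * (norm (0::'a) + \<bar>0\<bar>)) (nhds 0)"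
    by (intro tendsto_intros lim filterlim_ident)
  \<comment> \<open>With s = |z| + |\<mu>|, the threshold 1/2 bounds the quadratic error by s/2, and
    the half of |z| in it moves to the left side. This gives |z| \<le> (2 |v| + 1) |\<mu>|; adding
    |\<mu>| yields the constant of the next claim.\<close>
  then have "\<forall>\<^sub>F \<mu> in nhds 0. K * (norm (z \<mu>) + \<bar>\<mu>\<bar>) < 1 / 2"
    by (intro order_tendstoD(2)) auto
  with bound have "\<forall>\<^sub>F \<mu> in nhds 0. norm (norm (z \<mu>) + \<bar>\<mu>\<bar>) \<le> (2 * norm v + 2) * norm \<mu>"
  proof eventually_elim
    case (elim \<mu>)
    let ?s = "norm (z \<mu>) + \<bar>\<mu>\<bar>"
    have "K * ?s\<^sup>2 \<le> 1 / 2 * ?s"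
      unfolding power2_eq_square mult.assoc[symmetric]
      by (rule mult_right_mono) (use elim(2) in auto)
    with elim(1) have "norm (z \<mu> - \<mu> *\<^sub>R v) \<le> ?s / 2" by simp
    moreover have "norm (z \<mu>) \<le> norm (z \<mu> - \<mu> *\<^sub>R v) + \<bar>\<mu>\<bar> * norm v"
      using norm_triangle_sub[of "z \<mu>" "\<mu> *\<^sub>R v"] by simp
    ultimately have "norm (z \<mu>) \<le> 2 * (\<bar>\<mu>\<bar> * norm v) + \<bar>\<mu>\<bar>" by argo
    then show ?case by (simp add: algebra_simps)
  qed
  then have "(\<lambda>\<mu>. norm (z \<mu>) + \<bar>\<mu>\<bar>) \<in> O[nhds 0](\<lambda>\<mu>. \<mu>)"
    by (rule bigoI)
  then have "(\<lambda>\<mu>. (norm (z \<mu>) + \<bar>\<mu>\<bar>)\<^sup>2) \<in> O[nhds 0](\<lambda>\<mu>. \<mu>\<^sup>2)"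
    by (rule landau_o.big_power)
  with err show ?thesis by (rule landau_o.big_trans)
qed

text \<open>Turning an expansion into a limit lets uniqueness of limits identify a prescribed
  coefficient with a computed one.\<close>

lemma linear_expansion_tendsto_quotient:
  fixes f :: "real \<Rightarrow> real"
  assumes "(\<lambda>\<mu>. f \<mu> - a * \<mu>) \<in> O[nhds 0](\<lambda>\<mu>. \<mu>\<^sup>2)"
  shows "((\<lambda>\<mu>. f \<mu> / \<mu>) \<longlongrightarrow> a) (at 0)"
proof -
  obtain K where "\<forall>\<^sub>F \<mu> in nhds 0. norm (f \<mu> - a * \<mu>) \<le> K * norm (\<mu>\<^sup>2)"
    using assms by (elim landau_o.bigE)
  then have "\<forall>\<^sub>F \<mu> in at 0. norm (f \<mu> - a * \<mu>) \<le> K * norm (\<mu>\<^sup>2)"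
    by (simp add: eventually_nhds_conv_at)
  moreover have "\<forall>\<^sub>F \<mu> in at 0. \<mu> \<noteq> (0::real)"
    by (simp add: eventually_at_filter)
  ultimately have "\<forall>\<^sub>F \<mu> in at 0. norm (f \<mu> / \<mu> - a) \<le> norm \<mu> * K"
  proof eventually_elim
    case (elim \<mu>)
    have "norm (f \<mu> / \<mu> - a) = norm (f \<mu> - a * \<mu>) / norm \<mu>"
      using elim(2) by (simp add: field_simps flip: abs_divide)
    also have "\<dots> \<le> K * norm (\<mu>\<^sup>2) / norm \<mu>"
      by (rule divide_right_mono[OF elim(1)]) simp
    also have "\<dots> = norm \<mu> * K"
      using elim(2) by (auto simp: power2_eq_square abs_if)
    finally show ?case .
  qed
  moreover have "((\<lambda>\<mu>. \<mu>) \<longlongrightarrow> 0) (at (0::real))" by (rule tendsto_ident_at)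
  ultimately have "((\<lambda>\<mu>. f \<mu> / \<mu> - a) \<longlongrightarrow> 0) (at 0)"
    by (rule tendsto_0_le[rotated])
  then show ?thesis by (simp add: LIM_zero_iff)
qed

lemma quotient_tendsto_pos_imp_signs:
  fixes f :: "real \<Rightarrow> real"
  assumes "((\<lambda>\<mu>. f \<mu> / \<mu>) \<longlongrightarrow> a) (at 0)" and "a > 0"
  shows "\<forall>\<^sub>F \<mu> in at_left 0. f \<mu> < 0" and "\<forall>\<^sub>F \<mu> in at_right 0. f \<mu> > 0"
proof -
  have pos: "\<forall>\<^sub>F \<mu> in at 0. f \<mu> / \<mu> > 0"
    using order_tendstoD(1)[OF assms(1), of 0] assms(2) .
  then have quotient: "\<forall>\<^sub>F \<mu> in at_left 0. f \<mu> / \<mu> > 0" "\<forall>\<^sub>F \<mu> in at_right 0. f \<mu> / \<mu> > 0"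
    by (simp_all only: eventually_at_split)
  have "\<forall>\<^sub>F \<mu> in at_left 0. \<mu> < (0::real)"
    by (simp add: eventually_at_filter)
  with quotient(1) show "\<forall>\<^sub>F \<mu> in at_left 0. f \<mu> < 0"
    by eventually_elim (simp add: zero_less_divide_iff)
  have "\<forall>\<^sub>F \<mu> in at_right 0. \<mu> > (0::real)"
    by (simp add: eventually_at_filter)
  with quotient(2) show "\<forall>\<^sub>F \<mu> in at_right 0. f \<mu> > 0"
    by eventually_elim (simp add: zero_less_divide_iff)
qed

text \<open>Negating whichever function has negative slope reduces both cases to positive slopes,
  where the signs on each side of 0 are known.\<close>

lemma opposite_slopes_imp_persistence:
  fixes f g :: "real \<Rightarrow> real"
  assumes f: "((\<lambda>\<mu>. f \<mu> / \<mu>) \<longlongrightarrow> a) (at 0)" and g: "((\<lambda>\<mu>. g \<mu> / \<mu>) \<longlongrightarrow> b) (at 0)"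
    and "a * b < 0"
  shows "persistence (\<lambda>\<mu>. f \<mu> < 0) (\<lambda>\<mu>. g \<mu> < 0)"
proof -
  have neg: "((\<lambda>\<mu>. - h \<mu> / \<mu>) \<longlongrightarrow> - l) (at 0)"
    if "((\<lambda>\<mu>. h \<mu> / \<mu>) \<longlongrightarrow> l) (at 0)" for h :: "real \<Rightarrow> real" and l
    using tendsto_minus[OF that] by simp
  consider "a > 0" "- b > 0" | "- a > 0" "b > 0"
    using assms(3) by (auto simp: mult_less_0_iff)
  then show ?thesis
  proof cases
    case 1
    note signs = quotient_tendsto_pos_imp_signs[OF f 1(1)]
      quotient_tendsto_pos_imp_signs[OF neg[OF g] 1(2)]
    show ?thesis unfolding persistence_def
      by (rule disjI1) (intro conjI eventually_elim2[OF signs(1,3)] eventually_elim2[OF signs(2,4)]; simp)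
  next
    case 2
    note signs = quotient_tendsto_pos_imp_signs[OF neg[OF f] 2(1)]
      quotient_tendsto_pos_imp_signs[OF g 2(2)]
    show ?thesis unfolding persistence_def
      by (rule disjI2) (intro conjI eventually_elim2[OF signs(1,3)] eventually_elim2[OF signs(2,4)]; simp)
  qed
qed

section \<open>Equilibrium branches and their slopes\<close>

lemma unique_local_branchD:
  assumes "unique_local_branch E \<xi>"
  shows "(\<xi> \<longlongrightarrow> 0) (nhds 0)" and "\<forall>\<^sub>F \<mu> in nhds 0. E (\<xi> \<mu>) \<mu>"
proof -
  \<comment> \<open>Continuity gives a limit over the punctured neighbourhood; the value 0 at 0
    extends it to \<open>nhds 0\<close>, the filter of all the error bounds.\<close>
  show lim: "(\<xi> \<longlongrightarrow> 0) (nhds 0)"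
    using assms unfolding unique_local_branch_def isCont_def by (metis tendsto_at_iff_tendsto_nhds)
  have "((\<lambda>\<mu>. (\<xi> \<mu>, \<mu>)) \<longlongrightarrow> (0, 0)) (nhds 0)"
    by (intro tendsto_Pair lim filterlim_ident)
  from eventually_compose_filterlim[OF _ this] assms
  have "\<forall>\<^sub>F \<mu> in nhds 0. case (\<xi> \<mu>, \<mu>) of (x, \<mu>) \<Rightarrow> E x \<mu> \<longleftrightarrow> x = \<xi> \<mu>"
    unfolding unique_local_branch_def by blast
  then show "\<forall>\<^sub>F \<mu> in nhds 0. E (\<xi> \<mu>) \<mu>" by simp
qed

text \<open>Error terms are given on (x, \<mu>)-space. Along a branch, the norm of the pair is
  traded for the sum that \<open>implicit_linear_expansion\<close> expects.\<close>

lemma bigo_along_branch: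
  fixes G :: "'a::real_normed_vector \<times> real \<Rightarrow> real"
  assumes "G \<in> O[nhds (0, 0)](\<lambda>p. norm p ^ k)" and "(\<xi> \<longlongrightarrow> 0) (nhds 0)"
  shows "(\<lambda>\<mu>. G (\<xi> \<mu>, \<mu>)) \<in> O[nhds 0](\<lambda>\<mu>. (norm (\<xi> \<mu>) + \<bar>\<mu>\<bar>) ^ k)"
proof -
  have "((\<lambda>\<mu>. (\<xi> \<mu>, \<mu>)) \<longlongrightarrow> (0, 0)) (nhds 0)"
    by (intro tendsto_Pair assms(2) filterlim_ident)
  with assms(1) have "(\<lambda>\<mu>. G (\<xi> \<mu>, \<mu>)) \<in> O[nhds 0](\<lambda>\<mu>. norm (\<xi> \<mu>, \<mu>) ^ k)"
    by (rule landau_o.big.compose)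
  also have "(\<lambda>\<mu>. norm (\<xi> \<mu>, \<mu>) ^ k) \<in> O[nhds 0](\<lambda>\<mu>. (norm (\<xi> \<mu>) + \<bar>\<mu>\<bar>) ^ k)"
  proof (rule bigoI[where c = 1], rule always_eventually, rule allI)
    fix \<mu>
    have "norm (\<xi> \<mu>, \<mu>) ^ k \<le> (norm (\<xi> \<mu>) + \<bar>\<mu>\<bar>) ^ k"
      using norm_Pair_le[of "\<xi> \<mu>" \<mu>] by (intro power_mono) auto
    then show "norm (norm (\<xi> \<mu>, \<mu>) ^ k) \<le> 1 * norm ((norm (\<xi> \<mu>) + \<bar>\<mu>\<bar>) ^ k)"
      by simp
  qed
  finally show ?thesis .
qed

text \<open>Along the branch \<open>FR\<close> stays close to \<open>c\<close>, which is nonzero, so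
  the equilibrium must be a zero of \<open>FL\<close>. There \<open>Y\<close>, the inverse of
  \<open>A\<close>, maps the remainder of \<open>FL\<close> to minus the deviation of
  \<open>xL\<close> from its linear part, so the deviation inherits the quadratic bound.\<close>

lemma regular_equilibrium_slope:
  fixes FL FR :: "real ^ 'n::finite \<Rightarrow> real \<Rightarrow> real ^ 'n"
  assumes FL: "(\<lambda>(x, \<mu>). norm (FL x \<mu> - (A *v x + \<mu> *\<^sub>R b))) \<in> O[nhds (0, 0)](\<lambda>p. norm p ^ 2)"
    and FR: "(\<lambda>(x, \<mu>). norm (FR x \<mu> - c)) \<in> O[nhds (0, 0)](\<lambda>p. norm p)"
    and "c \<noteq> 0" and inverse: "Y ** A = Finite_Cartesian_Product.mat 1"
    and branch: "unique_local_branch (regular_equilibrium FL FR) xL"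
  shows "((\<lambda>\<mu>. xL \<mu> $ k / \<mu>) \<longlongrightarrow> - (Y *v b) $ k) (at 0)"
proof -
  note lim = unique_local_branchD(1)[OF branch]
  have small: "((\<lambda>\<mu>. norm (xL \<mu>) + \<bar>\<mu>\<bar>) \<longlongrightarrow> 0) (nhds 0)"
    using tendsto_add[OF tendsto_norm[OF lim] tendsto_rabs[OF filterlim_ident]] by simp
  have "(\<lambda>\<mu>. norm (FR (xL \<mu>) \<mu> - c)) \<in> O[nhds 0](\<lambda>\<mu>. norm (xL \<mu>) + \<bar>\<mu>\<bar>)"
    using bigo_along_branch[of _ 1, OF _ lim] FR by fastforce
  from bigo_tendsto_0[OF this small] have "((\<lambda>\<mu>. FR (xL \<mu>) \<mu>) \<longlongrightarrow> c) (nhds 0)"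
    by (simp add: tendsto_norm_zero_iff LIM_zero_iff)
  then have "\<forall>\<^sub>F \<mu> in nhds 0. FR (xL \<mu>) \<mu> \<noteq> 0"
    using \<open>c \<noteq> 0\<close> by (rule tendsto_imp_eventually_ne)
  with unique_local_branchD(2)[OF branch] have zero: "\<forall>\<^sub>F \<mu> in nhds 0. FL (xL \<mu>) \<mu> = 0"
    by eventually_elim (auto simp: regular_equilibrium_def)
  have "(\<lambda>\<mu>. norm (xL \<mu> - \<mu> *\<^sub>R (- (Y *v b)))) \<in>
      O[nhds 0](\<lambda>\<mu>. norm (FL (xL \<mu>) \<mu> - (A *v xL \<mu> + \<mu> *\<^sub>R b)))"
  proof -
    have "\<forall>\<^sub>F \<mu> in nhds 0. norm (Y *v (FL (xL \<mu>) \<mu> - (A *v xL \<mu> + \<mu> *\<^sub>R b))) =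
        norm (xL \<mu> - \<mu> *\<^sub>R (- (Y *v b)))"
      using zero
    proof eventually_elim
      case (elim \<mu>)
      have "Y *v (FL (xL \<mu>) \<mu> - (A *v xL \<mu> + \<mu> *\<^sub>R b)) = - (xL \<mu> - \<mu> *\<^sub>R (- (Y *v b)))"
        by (simp add: elim linear_neg[OF matrix_vector_mul_linear] matrix_vector_mult_diff_distrib matrix_vector_right_distrib
            matrix_vector_mul_assoc inverse matrix_vector_mult_scaleR)
      then show ?case by (metis norm_minus_cancel)
    qed
    from landau_o.big.in_cong[OF this] show ?thesis
      by (rule iffD1) (rule bigo_norm_linear_image[OF matrix_vector_mul_bounded_linear])
  qed
  also have "(\<lambda>\<mu>. norm (FL (xL \<mu>) \<mu> - (A *v xL \<mu> + \<mu> *\<^sub>R b))) \<in>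
      O[nhds 0](\<lambda>\<mu>. (norm (xL \<mu>) + \<bar>\<mu>\<bar>)\<^sup>2)"
    using bigo_along_branch[OF FL lim] by simp
  finally have "(\<lambda>\<mu>. norm (xL \<mu> - \<mu> *\<^sub>R (- (Y *v b)))) \<in> O[nhds 0](\<lambda>\<mu>. \<mu>\<^sup>2)"
    by (rule implicit_linear_expansion[OF lim])
  then have "(\<lambda>\<mu>. norm ((xL \<mu> - \<mu> *\<^sub>R (- (Y *v b))) $ k)) \<in> O[nhds 0](\<lambda>\<mu>. \<mu>\<^sup>2)"
    by (rule landau_o.big_trans[OF bigo_norm_linear_image[OF bounded_linear_vec_nth]])
  then have "(\<lambda>\<mu>. xL \<mu> $ k - (- (Y *v b) $ k) * \<mu>) \<in> O[nhds 0](\<lambda>\<mu>. \<mu>\<^sup>2)"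
    by (simp add: mult.commute)
  then show ?thesis by (rule linear_expansion_tendsto_quotient)
qed

text \<open>
  At a pseudo-equilibrium the two fields are parallel, \<open>F\<^sup>L = t F\<^sup>R\<close> with \<open>t = F\<^sup>L\<^sub>1 / F\<^sup>R\<^sub>1\<close>. To first
  order \<open>A x + b \<mu> = t c\<close>, so \<open>x = t A\<^sup>-\<^sup>1 c - \<mu> A\<^sup>-\<^sup>1 b\<close>, and \<open>x\<^sub>1 = 0\<close> determines \<open>t\<close>; finally
  \<open>\<chi> = t (F\<^sup>R\<^sub>1)\<^sup>2\<close>.
\<close>

lemma pseudo_equilibrium_slope:
  fixes FL FR :: "real ^ 'n::finite \<Rightarrow> real \<Rightarrow> real ^ 'n"
  assumes FL: "(\<lambda>(x, \<mu>). norm (FL x \<mu> - (A *v x + \<mu> *\<^sub>R b))) \<in> O[nhds (0, 0)](\<lambda>p. norm p ^ 2)"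
    and FR: "(\<lambda>(x, \<mu>). norm (FR x \<mu> - c)) \<in> O[nhds (0, 0)](\<lambda>p. norm p)"
    and c1: "c $ ix 1 \<noteq> 0" and inverse: "Y ** A = Finite_Cartesian_Product.mat 1"
    and w1: "(Y *v c) $ ix 1 \<noteq> 0"
    and branch: "unique_local_branch (pseudo_equilibrium ix FL FR) xS"
  shows "((\<lambda>\<mu>. chi ix FL FR (xS \<mu>) \<mu> / \<mu>) \<longlongrightarrow> (c $ ix 1)\<^sup>2 * ((Y *v b) $ ix 1 / (Y *v c) $ ix 1)) (at 0)"
proof -
  note lim = unique_local_branchD(1)[OF branch]
  define L where "L = (\<lambda>\<mu>. FL (xS \<mu>) \<mu>)"
  define R where "R = (\<lambda>\<mu>. FR (xS \<mu>) \<mu>)"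
  define t where "t = (\<lambda>\<mu>. L \<mu> $ ix 1 / R \<mu> $ ix 1)"
  define w where "w = Y *v c"
  define y where "y = - (Y *v b)"
  \<comment> \<open>Setting the first coordinate of x = \<mu> y + t w to zero gives t = \<tau>
    \<mu>.\<close>
  define \<tau> where "\<tau> = - y $ ix 1 / w $ ix 1"
  \<comment> \<open>The multiplier \<open>t\<close> is a second unknown, with its own part in the
    error, so \<open>implicit_linear_expansion\<close> is prepared for the pair of \<open>xS\<close>
    and \<open>t\<close>.\<close>
  define h where "h = (\<lambda>\<mu>. norm (xS \<mu>, t \<mu>) + \<bar>\<mu>\<bar>)"
  define e where "e = (\<lambda>\<mu>. A *v xS \<mu> + \<mu> *\<^sub>R b - t \<mu> *\<^sub>R c)"
  have small: "((\<lambda>\<mu>. norm (xS \<mu>) + \<bar>\<mu>\<bar>) \<longlongrightarrow> 0) (nhds 0)"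
    using tendsto_add[OF tendsto_norm[OF lim] tendsto_rabs[OF filterlim_ident]] by simp
  have L_err: "(\<lambda>\<mu>. norm (L \<mu> - (A *v xS \<mu> + \<mu> *\<^sub>R b))) \<in> O[nhds 0](\<lambda>\<mu>. (norm (xS \<mu>) + \<bar>\<mu>\<bar>)\<^sup>2)"
    using bigo_along_branch[OF FL lim] by (simp add: L_def)
  have R_err: "(\<lambda>\<mu>. norm (R \<mu> - c)) \<in> O[nhds 0](\<lambda>\<mu>. norm (xS \<mu>) + \<bar>\<mu>\<bar>)"
    using bigo_along_branch[of _ 1, OF _ lim] FR by (fastforce simp: R_def)
  have R_lim: "(R \<longlongrightarrow> c) (nhds 0)"
    using bigo_tendsto_0[OF R_err small] by (simp add: tendsto_norm_zero_iff LIM_zero_iff)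
  have L_lim: "(L \<longlongrightarrow> 0) (nhds 0)"
  proof -
    have "((\<lambda>\<mu>. (norm (xS \<mu>) + \<bar>\<mu>\<bar>)\<^sup>2) \<longlongrightarrow> 0) (nhds 0)"
      using tendsto_power[OF small, of 2] by simp
    from bigo_tendsto_0[OF L_err this]
    have "((\<lambda>\<mu>. L \<mu> - (A *v xS \<mu> + \<mu> *\<^sub>R b)) \<longlongrightarrow> 0) (nhds 0)"
      by (simp add: tendsto_norm_zero_iff)
    moreover have "((\<lambda>\<mu>. A *v xS \<mu> + \<mu> *\<^sub>R b) \<longlongrightarrow> A *v 0 + 0 *\<^sub>R b) (nhds 0)"
      by (intro tendsto_add tendsto_scaleR filterlim_ident tendsto_const
          bounded_linear.tendsto[OF matrix_vector_mul_bounded_linear lim])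
    ultimately show ?thesis using tendsto_add by fastforce
  qed
  have t_lim: "(t \<longlongrightarrow> 0) (nhds 0)"
    using tendsto_divide[OF tendsto_vec_nth[OF L_lim, of "ix 1"] tendsto_vec_nth[OF R_lim] c1]
    by (simp add: t_def)
  have R1: "\<forall>\<^sub>F \<mu> in nhds 0. R \<mu> $ ix 1 \<noteq> 0"
    using tendsto_vec_nth[OF R_lim] c1 by (rule tendsto_imp_eventually_ne)
  have parallel: "\<forall>\<^sub>F \<mu> in nhds 0. L \<mu> = t \<mu> *\<^sub>R R \<mu> \<and> xS \<mu> $ ix 1 = 0"
    using unique_local_branchD(2)[OF branch] R1
  proof eventually_elim
    case (elim \<mu>)
    then have eq: "(L \<mu> $ ix 1) *\<^sub>R R \<mu> = (R \<mu> $ ix 1) *\<^sub>R L \<mu>" and x1: "xS \<mu> $ ix 1 = 0"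
      by (auto simp: pseudo_equilibrium_def sliding_field_def L_def R_def)
    have "L \<mu> = (1 / R \<mu> $ ix 1) *\<^sub>R (R \<mu> $ ix 1) *\<^sub>R L \<mu>"
      using elim(2) by simp
    also have "\<dots> = t \<mu> *\<^sub>R R \<mu>"
      unfolding eq[symmetric] by (simp add: t_def)
    finally show ?case using x1 by simp
  qed
  have h_bound: "norm (xS \<mu>) + \<bar>\<mu>\<bar> \<le> h \<mu>" "\<bar>t \<mu>\<bar> \<le> h \<mu>" "h \<mu> \<ge> 0" for \<mu>
    using norm_fst_le[of "xS \<mu>" "t \<mu>"] norm_snd_le[of "t \<mu>" "xS \<mu>"] by (simp_all add: h_def)
  \<comment> \<open>Since \<open>L = t R\<close> along the branch, \<open>e\<close> is minus the
    remainder of \<open>L\<close> plus \<open>t (R - c)\<close>; the second term is a product of two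
    first-order quantities.\<close>
  have e_err: "(\<lambda>\<mu>. norm (e \<mu>)) \<in> O[nhds 0](\<lambda>\<mu>. (h \<mu>)\<^sup>2)"
  proof -
    have x_h: "(\<lambda>\<mu>. norm (xS \<mu>) + \<bar>\<mu>\<bar>) \<in> O[nhds 0](h)"
      by (rule bigoI[where c = 1]) (use h_bound in auto)
    have t_h: "(\<lambda>\<mu>. \<bar>t \<mu>\<bar>) \<in> O[nhds 0](h)"
      by (rule bigoI[where c = 1]) (use h_bound in auto)
    have "(\<lambda>\<mu>. norm (- (L \<mu> - (A *v xS \<mu> + \<mu> *\<^sub>R b)))) \<in> O[nhds 0](\<lambda>\<mu>. (h \<mu>)\<^sup>2)"
      unfolding norm_minus_cancel by (rule landau_o.big_trans[OF L_err landau_o.big_power[OF x_h]])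
    moreover have "(\<lambda>\<mu>. norm (t \<mu> *\<^sub>R (R \<mu> - c))) \<in> O[nhds 0](\<lambda>\<mu>. (h \<mu>)\<^sup>2)"
      using landau_o.big.mult[OF t_h landau_o.big_trans[OF R_err x_h]]
      by (simp add: power2_eq_square abs_mult)
    ultimately have "(\<lambda>\<mu>. norm (- (L \<mu> - (A *v xS \<mu> + \<mu> *\<^sub>R b)) + t \<mu> *\<^sub>R (R \<mu> - c))) \<in> O[nhds 0](\<lambda>\<mu>. (h \<mu>)\<^sup>2)"
      by (rule bigo_norm_add)
    moreover have "\<forall>\<^sub>F \<mu> in nhds 0. norm (- (L \<mu> - (A *v xS \<mu> + \<mu> *\<^sub>R b)) + t \<mu> *\<^sub>R (R \<mu> - c)) = norm (e \<mu>)"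
      using parallel by eventually_elim (simp add: e_def algebra_simps)
    ultimately show ?thesis by (rule landau_o.big.in_cong[THEN iffD1, rotated])
  qed
  have Ye: "Y *v e \<mu> = xS \<mu> - \<mu> *\<^sub>R y - t \<mu> *\<^sub>R w" for \<mu>
    by (simp add: e_def y_def w_def matrix_vector_mult_diff_distrib matrix_vector_right_distrib
        matrix_vector_mul_assoc inverse matrix_vector_mult_scaleR)
  have Ye_err: "(\<lambda>\<mu>. norm (Y *v e \<mu>)) \<in> O[nhds 0](\<lambda>\<mu>. (h \<mu>)\<^sup>2)"
    by (rule landau_o.big_trans[OF bigo_norm_linear_image e_err]) (rule matrix_vector_mul_bounded_linear)
  have "(\<lambda>\<mu>. norm ((xS \<mu>, t \<mu>) - \<mu> *\<^sub>R (y + \<tau> *\<^sub>R w, \<tau>))) \<in> O[nhds 0](\<lambda>\<mu>. (h \<mu>)\<^sup>2)"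
  proof -
    \<comment> \<open>\<open>T\<close> separates the unknowns in \<open>Y *v e \<mu>\<close>, which
      is x - \<mu> y - t w. As x has first coordinate 0, dividing the first coordinate by that of w
      leaves \<mu> \<tau> - t. Its negative is the deviation of t, and subtracting this multiple of
      w leaves that of x.\<close>
    define T where "T = (\<lambda>u. (u - (u $ ix 1 / w $ ix 1) *\<^sub>R w, - (u $ ix 1 / w $ ix 1)))"
    have "bounded_linear T"
      unfolding T_def
      by (intro bounded_linear_Pair bounded_linear_sub bounded_linear_ident bounded_linear_minus
          bounded_linear_compose[OF bounded_linear_scaleR_left, of "\<lambda>u. u $ ix 1 / w $ ix 1"]
          bounded_linear_compose[OF bounded_linear_divide, of "\<lambda>u. u $ ix 1"] bounded_linear_vec_nth)
    then have "(\<lambda>\<mu>. norm (T (Y *v e \<mu>))) \<in> O[nhds 0](\<lambda>\<mu>. (h \<mu>)\<^sup>2)"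
      by (rule landau_o.big_trans[OF bigo_norm_linear_image Ye_err])
    moreover have "\<forall>\<^sub>F \<mu> in nhds 0. norm (T (Y *v e \<mu>)) = norm ((xS \<mu>, t \<mu>) - \<mu> *\<^sub>R (y + \<tau> *\<^sub>R w, \<tau>))"
      using parallel
    proof eventually_elim
      case (elim \<mu>)
      have quotient: "(Y *v e \<mu>) $ ix 1 / w $ ix 1 = \<mu> * \<tau> - t \<mu>"
        using elim w1 by (simp add: Ye \<tau>_def w_def field_simps)
      then have "T (Y *v e \<mu>) = (xS \<mu>, t \<mu>) - \<mu> *\<^sub>R (y + \<tau> *\<^sub>R w, \<tau>)"
        unfolding T_def quotient by (simp add: Ye algebra_simps)
      then show ?case by simp
    qed
    ultimately show ?thesis by (rule landau_o.big.in_cong[THEN iffD1, rotated])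
  qed
  then have "(\<lambda>\<mu>. norm ((xS \<mu>, t \<mu>) - \<mu> *\<^sub>R (y + \<tau> *\<^sub>R w, \<tau>))) \<in> O[nhds 0](\<lambda>\<mu>. \<mu>\<^sup>2)"
    unfolding h_def
    by (intro implicit_linear_expansion) (use tendsto_Pair[OF lim t_lim] in \<open>simp_all add: zero_prod_def\<close>)
  from landau_o.big_trans[OF bigo_norm_linear_image[OF bounded_linear_snd] this]
  have "(\<lambda>\<mu>. t \<mu> - \<tau> * \<mu>) \<in> O[nhds 0](\<lambda>\<mu>. \<mu>\<^sup>2)"
    by (simp add: mult.commute)
  then have "((\<lambda>\<mu>. t \<mu> / \<mu>) \<longlongrightarrow> \<tau>) (at 0)"
    by (rule linear_expansion_tendsto_quotient)
  moreover have "((\<lambda>\<mu>. (R \<mu> $ ix 1)\<^sup>2) \<longlongrightarrow> (c $ ix 1)\<^sup>2) (at 0)"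
    by (intro tendsto_power tendsto_vec_nth tendsto_mono[OF _ R_lim]) (simp add: at_within_def)
  ultimately have "((\<lambda>\<mu>. (R \<mu> $ ix 1)\<^sup>2 * (t \<mu> / \<mu>)) \<longlongrightarrow> (c $ ix 1)\<^sup>2 * \<tau>) (at 0)"
    by (intro tendsto_mult)
  moreover have "\<forall>\<^sub>F \<mu> in at 0. (R \<mu> $ ix 1)\<^sup>2 * (t \<mu> / \<mu>) = chi ix FL FR (xS \<mu>) \<mu> / \<mu>"
  proof -
    have "\<forall>\<^sub>F \<mu> in at 0. R \<mu> $ ix 1 \<noteq> 0" using R1 by (simp add: eventually_nhds_conv_at)
    then show ?thesis
      by eventually_elim (simp add: t_def chi_def L_def R_def power2_eq_square)
  qed
  ultimately have "((\<lambda>\<mu>. chi ix FL FR (xS \<mu>) \<mu> / \<mu>) \<longlongrightarrow> (c $ ix 1)\<^sup>2 * \<tau>) (at 0)"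
    by (rule Lim_transform_eventually)
  then show ?thesis by (simp add: \<tau>_def y_def w_def)
qed

section \<open>The sign formula and persistence\<close>

lemma no_eigenvalue_on_imaginary_axis_imp_det_nonzero:
  assumes "B \<in> carrier_mat n n" and "no_eigenvalue_on_imaginary_axis B"
  shows "Determinant.det B \<noteq> 0"
  using sgn_det_eq_unstable_parity[OF assms] by auto

theorem mainTheorem2:
  fixes FL FR :: "real ^ 'n::finite \<Rightarrow> real \<Rightarrow> real ^ 'n"
    and A :: "real ^ 'n ^ 'n" and b c :: "real ^ 'n"
    and ix :: "nat \<Rightarrow> 'n"
    and xL xS :: "real \<Rightarrow> real ^ 'n" and \<alpha>\<^sub>L \<alpha>\<^sub>S :: real
  assumes "coordinate_numbering ix"
    and "C2 (\<lambda>(x, \<mu>). FL x \<mu>)" and "C2 (\<lambda>(x, \<mu>). FR x \<mu>)"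
    and "(\<lambda>(x, \<mu>). norm (FL x \<mu> - (A *v x + \<mu> *\<^sub>R b))) \<in> O[nhds (0, 0)](\<lambda>p. norm p ^ 2)"
    and "(\<lambda>(x, \<mu>). norm (FR x \<mu> - c)) \<in> O[nhds (0, 0)](\<lambda>p. norm p)"
    and "vec_nth c (ix 1) \<noteq> 0"
    and "no_eigenvalue_on_imaginary_axis (numbered_matrix ix A)"
    and "no_eigenvalue_on_imaginary_axis (sliding_block ix A c)"
    and "unique_local_branch (regular_equilibrium FL FR) xL"
    and "unique_local_branch (pseudo_equilibrium ix FL FR) xS"
    and "(\<lambda>\<mu>. vec_nth (xL \<mu>) (ix 1) - \<alpha>\<^sub>L * \<mu>) \<in> O[nhds 0](\<lambda>\<mu>. \<mu> ^ 2)"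
    and "(\<lambda>\<mu>. chi ix FL FR (xS \<mu>) \<mu> - \<alpha>\<^sub>S * \<mu>) \<in> O[nhds 0](\<lambda>\<mu>. \<mu> ^ 2)"
    and "\<alpha>\<^sub>L \<noteq> 0"
  shows "sgn (\<alpha>\<^sub>L * \<alpha>\<^sub>S) = (-1) ^ (D_L ix A + D_S ix A c + 1) \<and>
         (D_L ix A = 0 \<and> D_S ix A c = 0 \<longrightarrow>
            \<alpha>\<^sub>L * \<alpha>\<^sub>S < 0 \<and> persistence (admissible_L ix xL) (admissible_S ix FL FR xS))"
proof -
  let ?A = "numbered_matrix ix A" and ?M = "sliding_block ix A c"
  have block: "?M \<in> carrier_mat (CARD('n) - 1) (CARD('n) - 1)"
    unfolding sliding_block_def by (rule mat_delete_carrier) simp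
  note sgn_A = sgn_det_eq_unstable_parity[OF numbered_matrix_carrier assms(7)]
    and sgn_M = sgn_det_eq_unstable_parity[OF block assms(8)]
  note det_A = no_eigenvalue_on_imaginary_axis_imp_det_nonzero[OF numbered_matrix_carrier assms(7)]
    and det_M = no_eigenvalue_on_imaginary_axis_imp_det_nonzero[OF block assms(8)]
  obtain Y where Y: "Y ** A = Finite_Cartesian_Product.mat 1" "A ** Y = Finite_Cartesian_Product.mat 1"
    using det_numbered_matrix_nonzero_imp_inverse[OF assms(1) det_A] .
  define w where "w = (Y *v c) $ ix 1"
  have "A *v (Y *v c) = c"
    by (simp add: matrix_vector_mul_assoc Y)
  from det_sliding_block[OF assms(1,6) this]
  have det: "Determinant.det ?A * w = c $ ix 1 * Determinant.det ?M"
    unfolding w_def .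
  then have w: "w \<noteq> 0" using det_M assms(6) by auto
  note \<alpha>\<^sub>L = linear_expansion_tendsto_quotient[OF assms(11)]
    and \<alpha>\<^sub>S = linear_expansion_tendsto_quotient[OF assms(12)]
  have "c \<noteq> 0" using assms(6) by auto
  \<comment> \<open>The coefficients \<open>\<alpha>\<^sub>L\<close> and
    \<open>\<alpha>\<^sub>S\<close> are known only through their expansions; uniqueness of limits
    equates them with the computed slopes.\<close>
  from tendsto_unique[OF _ \<alpha>\<^sub>L regular_equilibrium_slope[OF assms(4,5) this Y(1) assms(9)]]
  have y: "(Y *v b) $ ix 1 = - \<alpha>\<^sub>L" by simp
  from tendsto_unique[OF _ \<alpha>\<^sub>S pseudo_equilibrium_slope[OF assms(4,5,6) Y(1) w[unfolded w_def] assms(10)]]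
  have "\<alpha>\<^sub>S = (c $ ix 1)\<^sup>2 * (- \<alpha>\<^sub>L / w)" by (simp add: y[simplified] w_def)
  \<comment> \<open>Up to the factor -1/w the product is a nonzero square, so only the sign of w
    remains to be found.\<close>
  then have "\<alpha>\<^sub>L * \<alpha>\<^sub>S = - ((c $ ix 1 * \<alpha>\<^sub>L)\<^sup>2 / w)"
    by (simp add: power2_eq_square)
  moreover have "sgn ((c $ ix 1 * \<alpha>\<^sub>L)\<^sup>2) = 1"
    using assms(6,13) by (simp add: sgn_1_pos del: power_sgn)
  ultimately have sgn_\<alpha>: "sgn (\<alpha>\<^sub>L * \<alpha>\<^sub>S) = - sgn w"
    by (simp add: sgn_divide)
  have sgn: "sgn (\<alpha>\<^sub>L * \<alpha>\<^sub>S) = (-1) ^ (D_L ix A + D_S ix A c + 1)"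
  proof -
    \<comment> \<open>Writing the dimension as \<open>Suc k\<close> makes the block size
      \<open>k\<close>; the parities of the two sizes differ, which gives the minus sign in front of
      \<open>sgn w\<close> below.\<close>
    obtain k where k: "CARD('n) = Suc k"
      using gr0_implies_Suc[OF zero_less_card_finite] by blast
    have "sgn (Determinant.det ?A) * sgn w = sgn (c $ ix 1) * sgn (Determinant.det ?M)"
      by (simp only: det flip: sgn_mult)
    then have "(-1) ^ (Suc k + D_L ix A) * sgn w =
        sgn (c $ ix 1) * (-1) ^ (k + unstable_eigenvalue_count ?M)"
      unfolding sgn_A sgn_M D_L_def k by simp
    then have "sgn w = - (sgn (c $ ix 1) * (-1) ^ (D_L ix A + unstable_eigenvalue_count ?M))"
      by (auto simp: minus_one_power_iff split: if_splits)
    \<comment> \<open>In this form the sign of \<open>c $ ix 1\<close> becomes the extra unstable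
      dimension in \<open>D_S\<close> of a repelling sliding region, and its minus sign cancels the
      one from the sizes.\<close>
    moreover have "sgn (c $ ix 1) = - ((-1) ^ (if c $ ix 1 > 0 then 1 else 0))"
      using assms(6) by (auto simp: sgn_if)
    ultimately show ?thesis
      unfolding sgn_\<alpha> D_S_def by (simp add: power_add del: sgn_minus)
  qed
  moreover have "\<alpha>\<^sub>L * \<alpha>\<^sub>S < 0" if "D_L ix A = 0" "D_S ix A c = 0"
  proof -
    have "sgn (\<alpha>\<^sub>L * \<alpha>\<^sub>S) = - 1" unfolding sgn that by simp
    then show ?thesis by (simp only: sgn_1_neg)
  qed
  moreover have "persistence (admissible_L ix xL) (admissible_S ix FL FR xS)" if "\<alpha>\<^sub>L * \<alpha>\<^sub>S < 0"
    using opposite_slopes_imp_persistence[OF \<alpha>\<^sub>L \<alpha>\<^sub>S that]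
    by (simp add: admissible_L_def[abs_def] admissible_S_def[abs_def])
  ultimately show ?thesis by blast
qed

end
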